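(* For each positive integer $n$ let $\Omega_n$ be the set of all $n^n$ functions $f:[n]\to[n]$, and let $E_n(\mathbf{B})=\frac{1}{n^n}\sum_{f\in\Omega_n}\mathbf{B}(f)$, where $\mathbf{B}(f)$ is the product, with multiplicities, of the lengths of the cycles of $f$. Then, as $n\to\infty$, $$E_n(\mathbf{B})=\exp\left(\tfrac{3}{2}\sqrt[3]{n}+O(n^{1/6})\right).$$
   Context: $[n]=\{1,\dots,n\}$. For $f:[n]\to[n]$, $f^{(t)}$ denotes $f$ composed with itself $t$ times. An element $v\in[n]$ is a cyclic vertex of $f$ if $f^{(t)}(v)=v$ for some $t\ge 1$. The restriction of $f$ to its set of cyclic vertices is a permutation of that set; the cycles of $f$ are the cycles of this permutation (fixed points count as cycles of length 1). "With multiplicities" means that each cycle contributes its length as one factor, so if several cycles have the same length, that length appears once for each of them. Equivalently, the cycles of $f$ are the directed cycles (including loops and 2-cycles) of the directed graph on $[n]$ with an edge from $v$ to $f(v)$ for each $v$. *)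

theory Defs
  imports Complex_Main "HOL-Library.FuncSet" "HOL-Library.Landau_Symbols" "HOL-Combinatorics.Orbits"
begin

text \<open>
  A function from \<open>[n]\<close> to \<open>[n]\<close> is represented by its unique extension to all of \<open>nat\<close> that takes
  the value \<^const>\<open>undefined\<close> outside \<open>[n]\<close>, so that this set has exactly \<open>n ^ n\<close> elements.
\<close>

definition mappings :: "nat \<Rightarrow> (nat \<Rightarrow> nat) set"
  where "mappings n = ({1..n} \<rightarrow>\<^sub>E {1..n})"

definition cyclic_vertices :: "nat \<Rightarrow> (nat \<Rightarrow> nat) \<Rightarrow> nat set"
  where "cyclic_vertices n f = {v \<in> {1..n}. \<exists>t\<ge>1. (f ^^ t) v = v}"

text \<open>
  A cycle is identified with its vertex set. Note that \<^term>\<open>orbit f v\<close> consists of the iterates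
  \<open>(f ^^ t) v\<close> with \<open>t \<ge> 1\<close>; it contains \<open>v\<close> when \<open>v\<close> is cyclic.
\<close>

definition cycles :: "nat \<Rightarrow> (nat \<Rightarrow> nat) \<Rightarrow> nat set set"
  where "cycles n f = orbit f ` cyclic_vertices n f"

text \<open>
  Different cycles are different sets, so a length shared by several cycles contributes one factor
  for each of them.
\<close>

definition cycle_length_prod :: "nat \<Rightarrow> (nat \<Rightarrow> nat) \<Rightarrow> nat"
  where "cycle_length_prod n f = (\<Prod>C\<in>cycles n f. card C)"

definition expected_B :: "nat \<Rightarrow> real"
  where "expected_B n = 1 / real (n ^ n) * (\<Sum>f\<in>mappings n. real (cycle_length_prod n f))"

end

theory Submission
  imports Defs "HOL-Computational_Algebra.Formal_Power_Series" "HOL-Real_Asymp.Real_Asymp"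
begin

text \<open>
  A sum over all functions of a product over their cycles becomes tractable once each cycle factor
  is written as \<open>w (card C) = 1 + (w (card C) - 1)\<close>: expanding the product, one chooses a set of
  cycles to keep, each with weight \<open>w (card C) - 1\<close>, and outside the kept cycles the function is
  arbitrary. Carried out one vertex at a time (\<open>cycle_weight_split\<close>, \<open>total_weight_rec\<close>), this shows that the exponential generating function
  in the size of the domain, for a fixed codomain of size \<open>n\<close>, is \<open>exp (n X)\<close> times the generating
  function of permutations weighted by the product of \<open>w (card C) - 1\<close>
  (\<open>total_weight_eq_fps_nth\<close>, which states it as a differential equation). For \<open>w k = k\<close> the second factor is
  \<open>(1 - X) exp (X / (1 - X))\<close>; call its coefficients \<open>c m\<close>. Hence (\<open>expected_B_eq_sum\<close>) the
  expectation is exactly the sum over \<open>m \<le> n\<close> of \<open>c m\<close> times the product of \<open>1 - i / n\<close> over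
  \<open>i < m\<close>.

  All summands are nonnegative. The coefficient \<open>c m\<close> is at most \<open>exp (2 sqrt m)\<close>
  (\<open>perm_gf_le\<close>), and this is sharp up to a polynomial factor at perfect squares
  (\<open>perm_gf_square_ge\<close>), while the product behaves like \<open>exp (- m\<^sup>2 / (2 n))\<close>. The exponent \<open>2 sqrt m - m\<^sup>2 / (2 n)\<close> is maximal at
  \<open>m = n powr (2 / 3)\<close>, where it equals \<open>3 / 2\<close> times the cube root of \<open>n\<close>. Bounding the \<open>n + 1\<close>
  summands by the largest possible value from above (\<open>expected_B_le\<close>), and the sum by one summand
  near the maximum from below (\<open>expected_B_ge\<close>), determines the expectation up to a factor polynomial
  in \<open>n\<close>. The error in the exponent is therefore \<open>O (ln n)\<close>, which is smaller than the required
  \<open>O (n powr (1 / 6))\<close>.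
\<close>

section \<open>Cycles inside a subset of the domain\<close>

text \<open>
  Deleting vertices from the domain leads to partial functions, so cycles are counted relative to
  a set: only those lying inside \<open>A\<close> matter, whatever \<open>f\<close> does elsewhere.
\<close>

definition cycles_within :: "'a set \<Rightarrow> ('a \<Rightarrow> 'a) \<Rightarrow> 'a set set"
  where "cycles_within A f = {C. C \<subseteq> A \<and> cyclic_on f C}"

definition cycle_weight :: "(nat \<Rightarrow> real) \<Rightarrow> 'a set \<Rightarrow> ('a \<Rightarrow> 'a) \<Rightarrow> real"
  where "cycle_weight w A f = (\<Prod>C\<in>cycles_within A f. w (card C))"

definition total_weight :: "(nat \<Rightarrow> real) \<Rightarrow> 'a set \<Rightarrow> 'a set \<Rightarrow> real"
  where "total_weight w A U = (\<Sum>f\<in>A \<rightarrow>\<^sub>E U. cycle_weight w A f)"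

lemma finite_cycles_within: "finite A \<Longrightarrow> finite (cycles_within A f)"
  unfolding cycles_within_def by (rule finite_subset[of _ "Pow A"]) auto

lemma cycles_within_eq_orbit: "C \<in> cycles_within A f \<Longrightarrow> x \<in> C \<Longrightarrow> C = orbit f x"
  by (auto simp: cycles_within_def orbit_cyclic_eq3)

lemma orbit_in_cycles_within:
  "a \<in> orbit f a \<Longrightarrow> orbit f a \<subseteq> A \<Longrightarrow> orbit f a \<in> cycles_within A f"
  by (auto simp: cycles_within_def intro: cyclic_on_singleI)

lemma cycle_weight_cong:
  assumes "\<And>x. x \<in> A \<Longrightarrow> f x = g x"
  shows "cycle_weight w A f = cycle_weight w A g"
proof -
  have "cyclic_on f C = cyclic_on g C" if "C \<subseteq> A" for C
    using that assms by (intro cyclic_cong) auto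
  then have "cycles_within A f = cycles_within A g"
    by (auto simp: cycles_within_def)
  then show ?thesis
    by (simp add: cycle_weight_def)
qed

text \<open>
  Write the weight of the cycle through \<open>a\<close>, if there is one, as \<open>1 + (w - 1)\<close>. The first summand
  forgets that cycle, leaving the cycles that avoid \<open>a\<close>; the second keeps it, and since distinct
  cycles are disjoint the remaining ones live on the complement of its vertex set. Forgetting is what
  makes the recursion close: once the cycle through \<open>a\<close> is ignored, the value \<open>f a\<close> is unconstrained.
\<close>

lemma cycle_weight_split:
  assumes "finite A" "a \<in> A"
  shows "cycle_weight w A f = cycle_weight w (A - {a}) f +
    (if a \<in> orbit f a \<and> orbit f a \<subseteq> A
     then (w (card (orbit f a)) - 1) * cycle_weight w (A - orbit f a) f else 0)"
proof (cases "a \<in> orbit f a \<and> orbit f a \<subseteq> A")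
  case True
  define D where "D = orbit f a"
  have D: "D \<in> cycles_within A f" "a \<in> D"
    using True by (auto simp: D_def intro: orbit_in_cycles_within)
  have disj: "C \<inter> D = {}" if "C \<in> cycles_within A f" "a \<notin> C" for C
    using that D cycles_within_eq_orbit by (metis disjoint_iff)
  have 1: "cycles_within (A - {a}) f = cycles_within (A - D) f"
    using disj D(2) by (auto simp: cycles_within_def)
  have 2: "cycles_within A f = insert D (cycles_within (A - D) f)"
  proof (intro equalityI subsetI)
    fix C assume C: "C \<in> cycles_within A f"
    show "C \<in> insert D (cycles_within (A - D) f)"
    proof (cases "a \<in> C")
      case True
      then show ?thesis using cycles_within_eq_orbit[OF C] by (simp add: D_def)
    next
      case False
      then show ?thesis using disj[OF C] C by (auto simp: cycles_within_def)
    qed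
  qed (use D in \<open>auto simp: cycles_within_def\<close>)
  have 3: "D \<notin> cycles_within (A - D) f"
    using D(2) by (auto simp: cycles_within_def)
  have "cycle_weight w A f = w (card D) * cycle_weight w (A - D) f"
    unfolding cycle_weight_def 2 using 3 assms(1) by (simp add: finite_cycles_within)
  moreover have "cycle_weight w (A - {a}) f = cycle_weight w (A - D) f"
    by (simp add: cycle_weight_def 1)
  ultimately show ?thesis
    using True by (simp add: D_def algebra_simps)
next
  case False
  have "a \<notin> C" if "C \<in> cycles_within A f" for C
    using cycles_within_eq_orbit[OF that, of a] that False by (auto simp: cycles_within_def)
  then have eq: "cycles_within (A - {a}) f = cycles_within A f"
    by (auto simp: cycles_within_def)
  show ?thesis
    unfolding cycle_weight_def eq using False by auto
qed

lemma sum_cycle_weight_delete: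
  assumes "a \<in> A"
  shows "(\<Sum>f\<in>A \<rightarrow>\<^sub>E U. cycle_weight w (A - {a}) f)
    = real (card U) * total_weight w (A - {a}) U"
proof -
  let ?B = "A - {a}"
  have A: "A \<rightarrow>\<^sub>E U = (\<lambda>(y, g). g(a := y)) ` (U \<times> (?B \<rightarrow>\<^sub>E U))"
    using PiE_insert_eq[of a ?B "\<lambda>_. U"] assms by (simp add: insert_absorb)
  have inj: "inj_on (\<lambda>(y, g). g(a := y)) (U \<times> (?B \<rightarrow>\<^sub>E U))"
    by (rule inj_combinator[where T = "\<lambda>_. U"]) simp
  have "(\<Sum>f\<in>A \<rightarrow>\<^sub>E U. cycle_weight w ?B f)
      = (\<Sum>(y, g)\<in>U \<times> (?B \<rightarrow>\<^sub>E U). cycle_weight w ?B (g(a := y)))"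
    unfolding A by (subst sum.reindex[OF inj]) (simp add: case_prod_unfold)
  also have "\<dots> = (\<Sum>(y, g)\<in>U \<times> (?B \<rightarrow>\<^sub>E U). cycle_weight w ?B g)"
  proof (intro sum.cong refl, clarify)
    fix y g
    show "cycle_weight w ?B (g(a := y)) = cycle_weight w ?B g"
      by (rule cycle_weight_cong) simp
  qed
  also have "\<dots> = real (card U) * total_weight w ?B U"
    by (simp add: total_weight_def sum.cartesian_product[symmetric])
  finally show ?thesis .
qed

section \<open>Cycles as words\<close>

text \<open>
  The cycle through \<open>a\<close>, read off starting at \<open>a\<close>. The root makes the word unique, so that summing
  over cycles through \<open>a\<close> becomes summing over distinct lists with head \<open>a\<close>.
\<close>

definition cycle_word :: "('a \<Rightarrow> 'a) \<Rightarrow> 'a \<Rightarrow> 'a list"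
  where "cycle_word f a = map (\<lambda>i. (f ^^ i) a) [0..<card (orbit f a)]"

definition rooted_words :: "'a set \<Rightarrow> 'a \<Rightarrow> 'a list set"
  where "rooted_words A a = {xs. xs \<noteq> [] \<and> hd xs = a \<and> distinct xs \<and> set xs \<subseteq> A}"

lemma cycle_word:
  assumes "a \<in> orbit f a"
  shows "set (cycle_word f a) = orbit f a" "distinct (cycle_word f a)"
    and "cycle_word f a \<noteq> []" "hd (cycle_word f a) = a"
    and "(f ^^ card (orbit f a)) a = a"
proof -
  define k where "k = funpow_dist1 f a a"
  have orb: "orbit f a = (\<lambda>n. (f ^^ n) a) ` {0..<k}"
    unfolding k_def by (rule orbit_conv_funpow_dist1[OF assms])
  have inj: "inj_on (\<lambda>n. (f ^^ n) a) {0..<k}"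
    unfolding k_def by (rule inj_on_funpow_dist1[OF assms])
  have k: "card (orbit f a) = k"
    unfolding orb using card_image[OF inj] by simp
  have "k > 0" by (simp add: k_def)
  then show "set (cycle_word f a) = orbit f a" "distinct (cycle_word f a)"
    and "cycle_word f a \<noteq> []" "hd (cycle_word f a) = a"
    using orb inj unfolding cycle_word_def k by (auto simp: distinct_map hd_map)
  show "(f ^^ card (orbit f a)) a = a"
    unfolding k k_def by (rule funpow_dist1_prop[OF assms])
qed

text \<open>
  Having a given word as the cycle through \<open>a\<close> only prescribes the values of \<open>f\<close> on the letters of
  the word. Hence the functions with this property correspond to arbitrary functions on the
  remaining vertices, which is how the next lemma uses it.
\<close>

lemma cycle_word_eq_iff:
  assumes "xs \<in> rooted_words A a"
  shows "a \<in> orbit f a \<and> cycle_word f a = xs \<longleftrightarrow>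
    (\<forall>i<length xs. f (xs ! i) = xs ! (Suc i mod length xs))"
proof
  assume *: "a \<in> orbit f a \<and> cycle_word f a = xs"
  have len: "length xs = card (orbit f a)"
    using * by (auto simp: cycle_word_def)
  have nth: "xs ! i = (f ^^ i) a" if "i < length xs" for i
    using * that by (auto simp: cycle_word_def)
  show "\<forall>i<length xs. f (xs ! i) = xs ! (Suc i mod length xs)"
  proof (intro allI impI)
    fix i assume i: "i < length xs"
    show "f (xs ! i) = xs ! (Suc i mod length xs)"
    proof (cases "Suc i = length xs")
      case True
      then have "f (xs ! i) = (f ^^ length xs) a"
        using nth[OF i] True[symmetric] by simp
      also have "\<dots> = a"
        using cycle_word(5) * len by metis
      finally show ?thesis
        using True i nth[of 0] by (cases "xs = []") auto
    next
      case False
      then show ?thesis using i nth by simp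
    qed
  qed
next
  assume *: "\<forall>i<length xs. f (xs ! i) = xs ! (Suc i mod length xs)"
  have xs: "xs \<noteq> []" "hd xs = a" "distinct xs"
    using assms by (auto simp: rooted_words_def)
  have it: "(f ^^ i) a = xs ! (i mod length xs)" for i
  proof (induction i)
    case 0
    then show ?case using xs by (simp add: hd_conv_nth)
  next
    case (Suc i)
    have "i mod length xs < length xs" using xs by simp
    then show ?case using Suc * by (simp add: mod_Suc_eq)
  qed
  have ret: "(f ^^ length xs) a = a"
    using it[of "length xs"] it[of 0] by simp
  have a: "a \<in> orbit f a"
    using ret xs(1) unfolding orbit_altdef by (force intro!: exI[of _ "length xs"])
  have "orbit f a = {(f ^^ m) a | m. m < length xs}"
    using xs(1) by (intro orbit_altdef_bounded[OF ret]) simp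
  also have "\<dots> = set xs"
    unfolding set_conv_nth by (intro Collect_cong ex_cong1) (auto simp: it)
  finally have "card (orbit f a) = length xs"
    using distinct_card[OF xs(3)] by simp
  then have "cycle_word f a = xs"
    unfolding cycle_word_def by (intro nth_equalityI) (auto simp: it)
  with a show "a \<in> orbit f a \<and> cycle_word f a = xs" by simp
qed

lemma sum_cycle_weight_prescribed:
  assumes "xs \<in> rooted_words A a" "A \<subseteq> U"
  shows "(\<Sum>f | f \<in> A \<rightarrow>\<^sub>E U \<and> (\<forall>i<length xs. f (xs ! i) = xs ! (Suc i mod length xs)).
      cycle_weight w (A - set xs) f) = total_weight w (A - set xs) U"
proof -
  let ?k = "length xs"
  \<comment> \<open>\<open>p\<close> sends each letter to its cyclic successor; the inverse of restriction extends \<open>g\<close> by \<open>p\<close>.\<close>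
  define p where "p v = xs ! (Suc (the_inv_into {..<?k} (nth xs) v) mod ?k)" for v
  have xs: "xs \<noteq> []" "distinct xs" "set xs \<subseteq> A"
    using assms by (auto simp: rooted_words_def)
  have p: "p (xs ! i) = xs ! (Suc i mod ?k)" if "i < ?k" for i
    using that xs(2) by (simp add: p_def the_inv_into_f_f inj_on_nth)
  have pU: "p v \<in> U" if "v \<in> set xs" for v
  proof -
    obtain i where "i < ?k" "v = xs ! i" using \<open>v \<in> set xs\<close> by (metis in_set_conv_nth)
    then have "p v \<in> set xs" using p xs(1) by simp
    then show ?thesis using xs(3) assms(2) by auto
  qed
  show ?thesis
    unfolding total_weight_def
  proof (rule sum.reindex_bij_witness[where j = "\<lambda>f. restrict f (A - set xs)"
        and i = "\<lambda>g v. if v \<in> set xs then p v else g v"])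
    fix f
    assume f: "f \<in> {f \<in> A \<rightarrow>\<^sub>E U. \<forall>i<?k. f (xs ! i) = xs ! (Suc i mod ?k)}"
    then have fE: "f \<in> A \<rightarrow>\<^sub>E U" by simp
    have fp: "f v = p v" if "v \<in> set xs" for v
      using that f p by (auto simp: in_set_conv_nth)
    show "(\<lambda>v. if v \<in> set xs then p v else restrict f (A - set xs) v) = f"
    proof
      fix v
      show "(if v \<in> set xs then p v else restrict f (A - set xs) v) = f v"
        using fp PiE_arb[OF fE] by simp
    qed
    show "restrict f (A - set xs) \<in> (A - set xs) \<rightarrow>\<^sub>E U"
      using fE by (simp add: PiE_iff)
    show "cycle_weight w (A - set xs) (restrict f (A - set xs)) = cycle_weight w (A - set xs) f"
      by (rule cycle_weight_cong) simp
  next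
    fix g assume g: "g \<in> (A - set xs) \<rightarrow>\<^sub>E U"
    show "restrict (\<lambda>v. if v \<in> set xs then p v else g v) (A - set xs) = g"
      using PiE_arb[OF g] by (intro ext) simp
    show "(\<lambda>v. if v \<in> set xs then p v else g v)
        \<in> {f \<in> A \<rightarrow>\<^sub>E U. \<forall>i<?k. f (xs ! i) = xs ! (Suc i mod ?k)}"
    proof -
      have "(\<lambda>v. if v \<in> set xs then p v else g v) \<in> A \<rightarrow>\<^sub>E U"
        using g xs(3) pU by (auto simp: PiE_iff extensional_def)
      then show ?thesis using p by simp
    qed
  qed
qed

lemma finite_rooted_words: "finite A \<Longrightarrow> finite (rooted_words A a)"
  by (rule finite_subset[OF _ finite_subset_distinct[of A]]) (auto simp: rooted_words_def)

text \<open>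
  Summing the splitting identity over all \<open>f\<close>, with the second part grouped by the cycle through \<open>a\<close>.
\<close>

lemma total_weight_rec:
  assumes "finite U" "A \<subseteq> U" "a \<in> A"
  shows "total_weight w A U = real (card U) * total_weight w (A - {a}) U +
    (\<Sum>xs\<in>rooted_words A a. (w (length xs) - 1) * total_weight w (A - set xs) U)"
proof -
  have fA: "finite A" using assms finite_subset by blast
  let ?F = "{f \<in> A \<rightarrow>\<^sub>E U. a \<in> orbit f a \<and> orbit f a \<subseteq> A}"
  let ?h = "\<lambda>f. (w (card (orbit f a)) - 1) * cycle_weight w (A - orbit f a) f"
  have fin: "finite (A \<rightarrow>\<^sub>E U)" using fA assms(1) by (simp add: finite_PiE)
  have img: "(\<lambda>f. cycle_word f a) ` ?F \<subseteq> rooted_words A a"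
    by (auto simp: rooted_words_def cycle_word)
  have fibre: "(\<Sum>f | f \<in> ?F \<and> cycle_word f a = xs. ?h f)
      = (w (length xs) - 1) * total_weight w (A - set xs) U"
    if xs: "xs \<in> rooted_words A a" for xs
  proof -
    have orb: "orbit f a = set xs" "card (orbit f a) = length xs"
      if "a \<in> orbit f a" "cycle_word f a = xs" for f
      using cycle_word(1)[OF that(1)] that(2) by (auto simp: cycle_word_def)
    have sub: "set xs \<subseteq> A" using xs by (simp add: rooted_words_def)
    have "{f. f \<in> ?F \<and> cycle_word f a = xs}
        = {f \<in> A \<rightarrow>\<^sub>E U. a \<in> orbit f a \<and> cycle_word f a = xs}"
      using orb sub by auto
    moreover have "?h f = (w (length xs) - 1) * cycle_weight w (A - set xs) f"
      if "a \<in> orbit f a" "cycle_word f a = xs" for f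
      by (subst orb(2)[OF that], subst orb(1)[OF that]) (rule refl)
    ultimately have "(\<Sum>f | f \<in> ?F \<and> cycle_word f a = xs. ?h f)
        = (\<Sum>f | f \<in> A \<rightarrow>\<^sub>E U \<and> a \<in> orbit f a \<and> cycle_word f a = xs.
            (w (length xs) - 1) * cycle_weight w (A - set xs) f)"
      by (intro sum.cong) simp_all
    then show ?thesis
      using sum_cycle_weight_prescribed[OF xs assms(2), of w]
      by (simp add: sum_distrib_left[symmetric] cycle_word_eq_iff[OF xs])
  qed
  have "total_weight w A U = (\<Sum>f\<in>A \<rightarrow>\<^sub>E U. cycle_weight w (A - {a}) f +
      (if a \<in> orbit f a \<and> orbit f a \<subseteq> A then ?h f else 0))"
    unfolding total_weight_def by (intro sum.cong refl cycle_weight_split fA assms(3))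
  also have "\<dots> = real (card U) * total_weight w (A - {a}) U + (\<Sum>f\<in>?F. ?h f)"
    by (simp only: sum.distrib sum_cycle_weight_delete[OF assms(3)] sum.inter_filter[OF fin])
  also have "(\<Sum>f\<in>?F. ?h f)
      = (\<Sum>xs\<in>rooted_words A a. \<Sum>f | f \<in> ?F \<and> cycle_word f a = xs. ?h f)"
    using fin by (intro sum.group[symmetric] img finite_rooted_words fA) auto
  also have "\<dots> = (\<Sum>xs\<in>rooted_words A a. (w (length xs) - 1) * total_weight w (A - set xs) U)"
    by (intro sum.cong refl fibre)
  finally show ?thesis .
qed

section \<open>The generating function\<close>

lemma card_rooted_words_of_length:
  assumes "finite A" "a \<in> A" "k < card A"
  shows "real (card {xs \<in> rooted_words A a. length xs = Suc k})
    = fact (card A - 1) / fact (card A - Suc k)"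
proof -
  let ?B = "A - {a}"
  have cB: "card ?B = card A - 1" using assms by simp
  have "{xs \<in> rooted_words A a. length xs = Suc k}
      = (#) a ` {xs. length xs = k \<and> distinct xs \<and> set xs \<subseteq> ?B}" (is "_ = _ ` ?S")
  proof (intro equalityI subsetI)
    fix xs assume "xs \<in> {xs \<in> rooted_words A a. length xs = Suc k}"
    then show "xs \<in> (#) a ` ?S"
      by (cases xs) (auto simp: rooted_words_def)
  qed (use assms in \<open>auto simp: rooted_words_def\<close>)
  then have "card {xs \<in> rooted_words A a. length xs = Suc k} = card ?S"
    by (simp add: card_image)
  also have "\<dots> = \<Prod>{card ?B - k + 1..card ?B}"
    using assms by (intro card_lists_distinct_length_eq) auto
  also have "real \<dots> = fact (card ?B) / fact (card ?B - k)"
  proof -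
    have "fact (card ?B) = fact (card ?B - k) * \<Prod>{card ?B - k + 1..card ?B}"
      using fact_eq_fact_times[of "card ?B - k" "card ?B"] by simp
    then have "real (fact (card ?B)) = fact (card ?B - k) * real (\<Prod>{card ?B - k + 1..card ?B})"
      by (metis of_nat_fact of_nat_mult)
    then show ?thesis by simp
  qed
  finally show ?thesis
    using cB by (simp add: diff_diff_eq)
qed

text \<open>
  By induction the total weight depends only on \<open>s = card A\<close>. There are \<open>(s-1)!/(s-k)!\<close> rooted
  words of length \<open>k\<close>, so after division by \<open>(s-1)!\<close> the recursion becomes the coefficient recursion
  of a linear differential equation for the exponential generating function in \<open>s\<close>, the size of
  the codomain being kept fixed.
\<close>

lemma total_weight_eq_fps_nth:
  fixes F :: "real fps"
  assumes "finite U" "fps_nth F 0 = 1"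
    and ode: "fps_deriv F = (of_nat (card U) + Abs_fps (\<lambda>k. w (Suc k) - 1)) * F"
  assumes "A \<subseteq> U"
  shows "total_weight w A U = fact (card A) * fps_nth F (card A)"
  using assms(4)
proof (induction "card A" arbitrary: A rule: less_induct)
  case less
  have fA: "finite A" using less.prems assms(1) finite_subset by blast
  show ?case
  proof (cases "A = {}")
    case True
    have "cycles_within {} f = {}" for f :: "'a \<Rightarrow> 'a"
      by (auto simp: cycles_within_def cyclic_on_def)
    then show ?thesis
      using True assms(2) by (simp add: total_weight_def cycle_weight_def)
  next
    case False
    then obtain a where a: "a \<in> A" by blast
    obtain s where s: "card A = Suc s"
      using False fA by (metis card_eq_0_iff not0_implies_Suc)
    have IH: "total_weight w B U = fact (card B) * fps_nth F (card B)" if "B \<subset> A" for B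
      using less.hyps[of B] that less.prems psubset_card_mono[OF fA that] by auto
    have len: "length xs \<in> {1..Suc s}" if "xs \<in> rooted_words A a" for xs
      using that card_mono[OF fA, of "set xs"]
      by (auto simp: rooted_words_def distinct_card s Suc_le_eq)
    have "(\<Sum>xs\<in>rooted_words A a. (w (length xs) - 1) * total_weight w (A - set xs) U)
       = (\<Sum>xs\<in>rooted_words A a. (w (length xs) - 1) *
            (fact (Suc s - length xs) * fps_nth F (Suc s - length xs)))"
    proof (intro sum.cong refl)
      fix xs assume xs: "xs \<in> rooted_words A a"
      have "a \<in> set xs" using xs by (auto simp: rooted_words_def)
      then have "A - set xs \<subset> A" using a by blast
      moreover have "card (A - set xs) = Suc s - length xs"
        using xs s by (auto simp: rooted_words_def card_Diff_subset distinct_card)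
      ultimately show "(w (length xs) - 1) * total_weight w (A - set xs) U =
          (w (length xs) - 1) * (fact (Suc s - length xs) * fps_nth F (Suc s - length xs))"
        using IH by simp
    qed
    also have "\<dots> = (\<Sum>k\<in>{1..Suc s}. \<Sum>xs | xs \<in> rooted_words A a \<and> length xs = k.
        (w (length xs) - 1) * (fact (Suc s - length xs) * fps_nth F (Suc s - length xs)))"
      using len by (intro sum.group[symmetric] finite_rooted_words fA) auto
    also have "\<dots> = (\<Sum>k\<in>{1..Suc s}. real (card {xs \<in> rooted_words A a. length xs = k}) *
        ((w k - 1) * (fact (Suc s - k) * fps_nth F (Suc s - k))))"
      by (intro sum.cong refl) simp
    also have "\<dots> = (\<Sum>k\<in>{0..s}. real (card {xs \<in> rooted_words A a. length xs = Suc k}) *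
        ((w (Suc k) - 1) * (fact (s - k) * fps_nth F (s - k))))"
      by (rule sum.reindex_bij_witness[of _ Suc "\<lambda>k. k - 1"]) auto
    also have "\<dots> = (\<Sum>k\<in>{0..s}. fact s * ((w (Suc k) - 1) * fps_nth F (s - k)))"
      by (intro sum.cong refl) (simp add: card_rooted_words_of_length[OF fA a] s)
    finally have "total_weight w A U = fact s * (real (card U) * fps_nth F s +
        (\<Sum>k=0..s. (w (Suc k) - 1) * fps_nth F (s - k)))"
      using total_weight_rec[OF assms(1) less.prems a, of w] IH[of "A - {a}"] a s
      by (auto simp: algebra_simps sum_distrib_left)
    also have "real (card U) * fps_nth F s + (\<Sum>k=0..s. (w (Suc k) - 1) * fps_nth F (s - k))
        = fps_nth (fps_deriv F) s"
    proof -
      have "fps_nth (of_nat (card U) * F) s = real (card U) * fps_nth F s"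
        by (metis fps_of_nat fps_mult_left_const_nth)
      then show ?thesis
        unfolding ode distrib_right fps_add_nth by (simp add: fps_mult_nth)
    qed
    finally show ?thesis
      using s by (simp add: algebra_simps)
  qed
qed

section \<open>Permutations weighted by cycle lengths minus one\<close>

text \<open>
  The series \<open>X / (1 - X)\<close>, that is, the exponential generating function of nonempty linear orders.
\<close>

definition list_gf :: "real fps"
  where "list_gf = Abs_fps (\<lambda>n. if n = 0 then 0 else 1)"

text \<open>
  The coefficient of \<open>X ^ m\<close> is the average, over the permutations of \<open>m\<close> points, of the product of
  \<open>card C - 1\<close> over the cycles \<open>C\<close>: the sum of \<open>(k - 1) X ^ k / k\<close> over \<open>k \<ge> 1\<close> is
  \<open>X / (1 - X) + ln (1 - X)\<close>.
\<close>

definition perm_gf :: "real fps"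
  where "perm_gf = (1 - fps_X) * (fps_exp 1 oo list_gf)"

lemma one_minus_X_mult_nth_Suc:
  fixes G :: "real fps"
  shows "fps_nth ((1 - fps_X) * G) (Suc m) = fps_nth G (Suc m) - fps_nth G m"
  by (simp add: left_diff_distrib)

lemma one_minus_X_mult_list_gf: "(1 - fps_X) * list_gf = fps_X"
proof (rule fps_ext)
  fix m show "fps_nth ((1 - fps_X) * list_gf) m = fps_nth fps_X m"
    by (cases m) (simp_all add: one_minus_X_mult_nth_Suc list_gf_def)
qed

text \<open>
  The logarithmic derivative of a permutation series is the series of cycle weights, here the sum of
  \<open>k X ^ k\<close>. Each quotient enters the proof only through its product with \<open>1 - X\<close>.
\<close>

lemma fps_deriv_perm_gf: "fps_deriv perm_gf = Abs_fps (\<lambda>k. real k) * perm_gf"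
proof -
  let ?E = "fps_exp 1 oo list_gf"
  have E: "fps_deriv ?E = ?E * fps_deriv list_gf"
    by (subst fps_compose_deriv) (simp_all add: list_gf_def)
  have "fps_deriv ((1 - fps_X) * list_gf) = 1"
    by (simp add: one_minus_X_mult_list_gf)
  then have D: "(1 - fps_X) * fps_deriv list_gf = 1 + list_gf"
    by (simp add: algebra_simps)
  have H: "Abs_fps (\<lambda>k. real k) * (1 - fps_X) = list_gf"
  proof (rule fps_ext)
    fix m show "fps_nth (Abs_fps (\<lambda>k. real k) * (1 - fps_X)) m = fps_nth list_gf m"
      by (subst mult.commute, cases m) (simp_all add: one_minus_X_mult_nth_Suc list_gf_def)
  qed
  have "fps_deriv perm_gf = ?E * ((1 - fps_X) * fps_deriv list_gf) - ?E"
    by (simp add: perm_gf_def E algebra_simps)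
  also have "\<dots> = ?E * list_gf"
    unfolding D by (simp add: algebra_simps)
  also have "\<dots> = Abs_fps (\<lambda>k. real k) * perm_gf"
    unfolding H[symmetric] perm_gf_def by (simp add: mult_ac)
  finally show ?thesis .
qed

lemma perm_gf_0: "fps_nth perm_gf 0 = 1"
  by (simp add: perm_gf_def)

lemma perm_gf_rec:
  "real (Suc m) * fps_nth perm_gf (Suc m) = (\<Sum>i=0..m. real i * fps_nth perm_gf (m - i))"
  using arg_cong[OF fps_deriv_perm_gf, of "\<lambda>G. fps_nth G m"] by (simp add: fps_mult_nth)

lemma perm_gf_nonneg: "fps_nth perm_gf m \<ge> 0"
proof (induction m rule: less_induct)
  case (less m)
  show ?case
  proof (cases m)
    case (Suc k)
    have "real (Suc k) * fps_nth perm_gf (Suc k) \<ge> 0"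
      unfolding perm_gf_rec using less Suc by (intro sum_nonneg mult_nonneg_nonneg) auto
    then show ?thesis
      unfolding Suc by (simp add: zero_le_mult_iff)
  qed (simp add: perm_gf_0)
qed

lemma sum_arith_geometric_bound:
  fixes q :: real
  assumes "0 \<le> q" "q \<le> 1"
  shows "(1 - q)\<^sup>2 * (\<Sum>i=0..m. real i * q ^ Suc i) \<le> q\<^sup>2"
proof -
  have "(1 - q)\<^sup>2 * (\<Sum>i=0..m. real i * q ^ Suc i)
      = q\<^sup>2 - q ^ (m + 2) * (1 + real m * (1 - q))"
    by (induction m) (simp_all add: algebra_simps power2_eq_square)
  also have "\<dots> \<le> q\<^sup>2" using assms by simp
  finally show ?thesis .
qed

text \<open>
  The exponent \<open>2 sqrt m\<close> is exactly what the recursion reproduces. With \<open>r = sqrt (k + 1)\<close>, concavity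
  of the square root gives \<open>2 sqrt (k - i) \<le> 2 r - (i + 1) / r\<close>. The sum over \<open>i\<close> is then dominated by an
  arithmetic-geometric series with ratio \<open>q = exp (- 1 / r)\<close>, whose value is at most
  \<open>(q / (1 - q))\<^sup>2 \<le> r\<^sup>2 = k + 1\<close>.
\<close>

lemma perm_gf_le: "fps_nth perm_gf m \<le> exp (2 * sqrt (real m))"
proof (induction m rule: less_induct)
  case (less m)
  show ?case
  proof (cases m)
    case (Suc k)
    define r where "r = sqrt (real (Suc k))"
    define q where "q = exp (- (1 / r))"
    have r: "r > 0" "r\<^sup>2 = real (Suc k)" by (simp_all add: r_def)
    have q: "0 < q" "q < 1" using r by (simp_all add: q_def)
    have step: "exp (2 * sqrt (real (k - i))) \<le> exp (2 * r) * q ^ Suc i" if "i \<le> k" for i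
    proof -
      have "(r - sqrt (real (k - i)))\<^sup>2 \<ge> 0" by simp
      then have "2 * r * sqrt (real (k - i)) \<le> r\<^sup>2 + (sqrt (real (k - i)))\<^sup>2"
        by (simp add: power2_diff)
      also have "\<dots> = 2 * r\<^sup>2 - real (Suc i)"
        unfolding r(2) using that by (simp add: of_nat_diff)
      also have "\<dots> = r * (2 * r - real (Suc i) / r)"
        using r(1) by (simp add: field_simps power2_eq_square)
      finally have "r * (2 * sqrt (real (k - i))) \<le> r * (2 * r - real (Suc i) / r)"
        by (simp add: mult_ac)
      then have "2 * sqrt (real (k - i)) \<le> 2 * r - real (Suc i) / r"
        using r(1) by (simp only: mult_le_cancel_left_pos)
      then have "exp (2 * sqrt (real (k - i))) \<le> exp (2 * r + real (Suc i) * (- (1 / r)))"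
        by simp
      also have "\<dots> = exp (2 * r) * q ^ Suc i"
        unfolding q_def exp_of_nat_mult[symmetric] by (rule exp_add)
      finally show ?thesis .
    qed
    have "1 + 1 / r \<le> exp (1 / r)" by (rule exp_ge_add_one_self)
    then have "q * (1 + 1 / r) \<le> q * exp (1 / r)"
      using q by (intro mult_left_mono) auto
    also have "q * exp (1 / r) = 1"
      by (simp add: q_def exp_add[symmetric])
    finally have "q \<le> r * (1 - q)"
      using r(1) by (simp add: field_simps)
    then have "q\<^sup>2 \<le> (r * (1 - q))\<^sup>2"
      using q by (intro power_mono) auto
    then have qr: "q\<^sup>2 \<le> real (Suc k) * (1 - q)\<^sup>2"
      by (simp only: power_mult_distrib r(2))
    have "(1 - q)\<^sup>2 * (\<Sum>i=0..k. real i * q ^ Suc i) \<le> q\<^sup>2"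
      by (rule sum_arith_geometric_bound) (use q in auto)
    also have "\<dots> \<le> (1 - q)\<^sup>2 * real (Suc k)"
      using qr by (simp only: mult.commute)
    finally have S: "(\<Sum>i=0..k. real i * q ^ Suc i) \<le> real (Suc k)"
      using q by (subst (asm) mult_le_cancel_left_pos) auto
    have "real (Suc k) * fps_nth perm_gf (Suc k)
        \<le> (\<Sum>i=0..k. real i * (exp (2 * r) * q ^ Suc i))"
      unfolding perm_gf_rec
    proof (intro sum_mono mult_left_mono)
      fix i assume "i \<in> {0..k}"
      then show "fps_nth perm_gf (k - i) \<le> exp (2 * r) * q ^ Suc i"
        using less[of "k - i"] step[of i] Suc by force
    qed auto
    also have "\<dots> = exp (2 * r) * (\<Sum>i=0..k. real i * q ^ Suc i)"
      by (simp add: sum_distrib_left mult_ac)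
    also have "\<dots> \<le> exp (2 * r) * real (Suc k)"
      using S by simp
    finally have "real (Suc k) * fps_nth perm_gf (Suc k) \<le> real (Suc k) * exp (2 * r)"
      by (simp add: mult.commute)
    then show ?thesis
      unfolding Suc r_def by (subst (asm) mult_le_cancel_left_pos) auto
  qed (simp add: perm_gf_0)
qed

text \<open>
  Multiplying by \<open>1 - X\<close> turns the step from one power to the next into Pascal's rule.
\<close>

lemma list_gf_power_nth:
  "fps_nth (list_gf ^ Suc j) 0 = 0 \<and>
   fps_nth (list_gf ^ Suc j) (Suc m) = real (m choose j)"
proof (induction j arbitrary: m)
  case 0
  show ?case by (simp add: list_gf_def)
next
  case (Suc j)
  note IH = Suc.IH
  have G: "(1 - fps_X) * list_gf ^ Suc (Suc j) = fps_X * list_gf ^ Suc j"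
    by (metis mult.assoc one_minus_X_mult_list_gf power_Suc)
  have 0: "fps_nth (list_gf ^ Suc (Suc j)) 0 = 0"
    by (simp add: list_gf_def)
  have step: "fps_nth (list_gf ^ Suc (Suc j)) (Suc m)
      = fps_nth (list_gf ^ Suc (Suc j)) m + fps_nth (list_gf ^ Suc j) m" for m
    using one_minus_X_mult_nth_Suc[of "list_gf ^ Suc (Suc j)" m] unfolding G
    by (simp del: power_Suc)
  have "fps_nth (list_gf ^ Suc (Suc j)) (Suc m) = real (m choose Suc j)" for m
  proof (induction m)
    case 0
    then show ?case using step[of 0] IH[of 0] 0 by (simp del: power_Suc)
  next
    case (Suc m)
    then show ?case using step[of "Suc m"] IH[of m] by (simp del: power_Suc)
  qed
  with 0 show ?case by blast
qed

text \<open>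
  In the expansion of \<open>(1 - X) exp (X / (1 - X))\<close> by powers of \<open>X / (1 - X)\<close>, every summand has
  nonnegative coefficients at degrees \<open>\<ge> 2\<close>, so any single one gives a lower bound.
\<close>

lemma perm_gf_ge:
  assumes "j \<le> m"
  shows "fps_nth perm_gf (m + 2) \<ge> real (m choose j) / fact (j + 2)"
proof -
  have *: "fps_nth (fps_exp 1 oo list_gf) k = (\<Sum>i\<in>{0..m+2}. fps_nth (list_gf ^ i) k / fact i)"
    if "k \<le> m + 2" for k
  proof -
    have "fps_nth (list_gf ^ i) k = 0" if "i > k" for i
      using that startsby_zero_power_prefix[of list_gf] by (auto simp: list_gf_def)
    then have "(\<Sum>i\<in>{0..m+2}. fps_nth (list_gf ^ i) k / fact i)
      = (\<Sum>i\<in>{0..k}. fps_nth (list_gf ^ i) k / fact i)"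
      using that by (intro sum.mono_neutral_right) auto
    then show ?thesis by (simp add: fps_compose_nth)
  qed
  \<comment> \<open>The contribution of the \<open>i\<close>-th power to the coefficient of \<open>X ^ (m + 2)\<close>,
     including the factor \<open>1 / i!\<close>\<close>
  let ?d = "\<lambda>i. (fps_nth (list_gf ^ i) (m + 2) - fps_nth (list_gf ^ i) (m + 1)) / fact i"
  have d: "fps_nth (list_gf ^ Suc (Suc i)) (m + 2) - fps_nth (list_gf ^ Suc (Suc i)) (m + 1)
      = real (m choose i)" for i
    using list_gf_power_nth[of "Suc i" "Suc m"] list_gf_power_nth[of "Suc i" m]
    by (simp del: power_Suc)
  have "?d i \<ge> 0" for i
  proof -
    consider "i = 0" | "i = 1" | i' where "i = Suc (Suc i')"
      by (metis One_nat_def old.nat.exhaust)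
    then show ?thesis
      by cases (use d in \<open>simp_all add: list_gf_def del: power_Suc\<close>)
  qed
  then have "?d (j + 2) \<le> (\<Sum>i\<in>{0..m+2}. ?d i)"
    using assms by (intro member_le_sum) auto
  also have "\<dots> = fps_nth perm_gf (m + 2)"
    using one_minus_X_mult_nth_Suc[of "fps_exp 1 oo list_gf" "m + 1"] *[of "m + 1"] *[of "m + 2"]
    by (simp add: perm_gf_def diff_divide_distrib sum_subtractf)
  finally show ?thesis using d[of j] by simp
qed

section \<open>An exact formula for the expectation\<close>

lemma expected_B_eq_total_weight:
  "expected_B n = total_weight real {1..n} {1..n} / real (n ^ n)"
proof -
  have "real (cycle_length_prod n f) = cycle_weight real {1..n} f" if f: "f \<in> {1..n} \<rightarrow>\<^sub>E {1..n}" for f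
  proof -
    have orb: "orbit f v \<subseteq> {1..n}" if v: "v \<in> {1..n}" for v
    proof
      fix y assume "y \<in> orbit f v"
      then show "y \<in> {1..n}"
        by induction (use f v in \<open>auto dest: PiE_mem\<close>)
    qed
    have cyc: "v \<in> cyclic_vertices n f \<longleftrightarrow> v \<in> {1..n} \<and> v \<in> orbit f v" for v
      by (auto simp: cyclic_vertices_def orbit_altdef Suc_le_eq) metis+
    have "cycles n f = cycles_within {1..n} f"
    proof (intro equalityI subsetI)
      fix C assume "C \<in> cycles n f"
      then show "C \<in> cycles_within {1..n} f"
        using cyc orb by (auto simp: cycles_def intro: orbit_in_cycles_within)
    next
      fix C assume C: "C \<in> cycles_within {1..n} f"
      then obtain v where v: "v \<in> C" "C = orbit f v" "C \<subseteq> {1..n}"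
        by (auto simp: cycles_within_def cyclic_on_def)
      then show "C \<in> cycles n f"
        unfolding cycles_def using cyc by blast
    qed
    then show ?thesis
      by (simp add: cycle_length_prod_def cycle_weight_def)
  qed
  then show ?thesis
    by (simp add: expected_B_def total_weight_def mappings_def)
qed

lemma fact_quotient_eq_prod:
  assumes "m \<le> n"
  shows "fact n / (fact (n - m) * real n ^ m) = (\<Prod>i<m. 1 - real i / real n)"
  using assms
proof (induction m)
  case (Suc m)
  define d where "d = real (n - m)"
  have d: "d \<noteq> 0" "d / real n = 1 - real m / real n"
    using Suc.prems by (simp_all add: d_def of_nat_diff diff_divide_distrib)
  have "fact (n - m) = d * fact (n - Suc m)"
    unfolding d_def using Suc.prems by (metis Suc_diff_Suc Suc_le_lessD fact_Suc)
  then have "fact n / (fact (n - Suc m) * real n ^ Suc m)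
      = fact n / (fact (n - m) * real n ^ m) * (d / real n)"
    using d(1) by simp
  then show ?case using Suc d(2) by simp
qed simp

text \<open>
  For \<open>w k = k\<close> and a codomain of size \<open>n\<close>, the differential equation is solved by
  \<open>exp (n X)\<close> times \<^const>\<open>perm_gf\<close>. The product below is the falling factorial
  \<open>n (n - 1) \<dots> (n - m + 1)\<close> divided by \<open>n ^ m\<close>.
\<close>

lemma expected_B_eq_sum:
  assumes "n \<ge> 1"
  shows "expected_B n = (\<Sum>m=0..n. fps_nth perm_gf m * (\<Prod>i<m. 1 - real i / real n))"
proof -
  let ?F = "fps_exp (real n) * perm_gf"
  have "total_weight real {1..n} {1..n} = fact (card {1..n}) * fps_nth ?F (card {1..n})"
  proof (rule total_weight_eq_fps_nth)
    show "fps_deriv ?F = (of_nat (card {1..n}) + Abs_fps (\<lambda>k. real (Suc k) - 1)) * ?F"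
      by (simp add: fps_deriv_perm_gf fps_of_nat algebra_simps)
  qed (simp_all add: perm_gf_0)
  also have "\<dots> = fact n * (\<Sum>m=0..n. fps_nth perm_gf m * (real n ^ (n - m) / fact (n - m)))"
    by (subst mult.commute[of "fps_exp _"]) (simp add: fps_mult_nth)
  finally have "expected_B n = (\<Sum>m=0..n. fps_nth perm_gf m *
      (fact n * real n ^ (n - m) / (fact (n - m) * real n ^ n)))"
    unfolding expected_B_eq_total_weight by (simp add: sum_distrib_left sum_divide_distrib mult_ac)
  also have "\<dots> = (\<Sum>m=0..n. fps_nth perm_gf m * (\<Prod>i<m. 1 - real i / real n))"
  proof (intro sum.cong refl)
    fix m assume "m \<in> {0..n}"
    then have m: "m \<le> n" by simp
    have "real n ^ n = real n ^ m * real n ^ (n - m)"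
      using m by (simp add: power_add[symmetric])
    then show "fps_nth perm_gf m * (fact n * real n ^ (n - m) / (fact (n - m) * real n ^ n))
        = fps_nth perm_gf m * (\<Prod>i<m. 1 - real i / real n)"
      using assms by (simp add: fact_quotient_eq_prod[OF m, symmetric])
  qed
  finally show ?thesis .
qed

section \<open>The upper bound\<close>

lemma sum_lessThan_real: "(\<Sum>i<m. real i) = real m * (real m - 1) / 2"
  by (induction m) (simp_all add: field_simps)

lemma prod_one_minus_le:
  assumes "m \<le> n"
  shows "(\<Prod>i<m. 1 - real i / real n) \<le> exp (- (real m * (real m - 1) / (2 * real n)))"
proof -
  have "(\<Prod>i<m. 1 - real i / real n) \<le> (\<Prod>i<m. exp (- (real i / real n)))"
    using assms exp_ge_add_one_self[of "- (real i / real n)" for i]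
    by (intro prod_mono) (auto simp: divide_le_eq_1)
  also have "\<dots> = exp (- (\<Sum>i<m. real i) / real n)"
    by (simp add: exp_sum[symmetric] sum_negf sum_divide_distrib)
  finally show ?thesis by (simp add: sum_lessThan_real)
qed

text \<open>
  With \<open>y = sqrt m\<close> and \<open>a\<close> the cube root of \<open>n\<close>, this maximizes the main part of the
  exponent of the \<open>m\<close>-th summand;
  the maximum is attained at \<open>y = a\<close>, which accounts for the double root in the factorization.
\<close>

lemma exponent_le:
  assumes "a > 0" "y \<ge> (0::real)"
  shows "2 * y - y ^ 4 / (2 * a ^ 3) \<le> 3 / 2 * a"
proof -
  have "0 \<le> (y - a)\<^sup>2 * ((y + a)\<^sup>2 + 2 * a\<^sup>2)"
    by simp
  also have "\<dots> = 3 * a ^ 4 + y ^ 4 - 4 * y * a ^ 3"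
    by (simp add: algebra_simps power2_eq_square power3_eq_cube power4_eq_xxxx)
  finally show ?thesis
    using assms(1) by (simp add: field_simps power4_eq_xxxx power3_eq_cube)
qed

lemma expected_B_le:
  assumes "n \<ge> 1"
  shows "expected_B n \<le> (real n + 1) * exp (3 / 2 * root 3 (real n) + 1 / 2)"
proof -
  define a where "a = root 3 (real n)"
  have a: "a > 0" "a ^ 3 = real n"
    using assms by (simp_all add: a_def)
  have "fps_nth perm_gf m * (\<Prod>i<m. 1 - real i / real n) \<le> exp (3 / 2 * a + 1 / 2)"
    if m: "m \<le> n" for m
  proof -
    have "0 \<le> (\<Prod>i<m. 1 - real i / real n)"
      using m by (intro prod_nonneg) (auto simp: divide_le_eq_1)
    then have "fps_nth perm_gf m * (\<Prod>i<m. 1 - real i / real n)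
        \<le> exp (2 * sqrt (real m)) * exp (- (real m * (real m - 1) / (2 * real n)))"
      using perm_gf_le prod_one_minus_le[OF m] by (intro mult_mono) auto
    also have "\<dots> = exp (2 * sqrt (real m) - (real m)\<^sup>2 / (2 * real n) + real m / (2 * real n))"
      unfolding exp_add[symmetric] by (simp add: power2_eq_square algebra_simps diff_divide_distrib)
    also have "\<dots> \<le> exp (3 / 2 * a + 1 / 2)"
    proof -
      have "sqrt (real m) ^ 4 = (real m)\<^sup>2"
        using power_mult[of "sqrt (real m)" 2 2] by simp
      then have "2 * sqrt (real m) - (real m)\<^sup>2 / (2 * real n) \<le> 3 / 2 * a"
        using exponent_le[OF a(1), of "sqrt (real m)"] a(2) by simp
      moreover have "real m / (2 * real n) \<le> 1 / 2"
        using m assms by (simp add: field_simps)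
      ultimately show ?thesis by simp
    qed
    finally show ?thesis .
  qed
  then have "expected_B n \<le> (\<Sum>m=0..n. exp (3 / 2 * a + 1 / 2))"
    unfolding expected_B_eq_sum[OF assms] by (intro sum_mono) auto
  then show ?thesis by (simp add: a_def algebra_simps)
qed

section \<open>The lower bound\<close>

lemma prod_one_minus_ge:
  assumes "2 * m \<le> n" "n \<ge> 1" "m ^ 3 \<le> n\<^sup>2"
  shows "(\<Prod>i<m. 1 - real i / real n) \<ge> exp (- ((real m)\<^sup>2 / (2 * real n)) - 2)"
proof -
  have i: "real i / real n \<le> 1 / 2" if "i < m" for i
    using that assms by (simp add: field_simps)
  \<comment> \<open>The quadratic error in \<open>ln (1 - x) \<ge> - x - 2 x\<^sup>2\<close> adds up to at most \<open>2 m ^ 3 / n\<^sup>2 \<le> 2\<close>.\<close>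
  have sq: "(\<Sum>i<m. 2 * (real i / real n)\<^sup>2) \<le> 2"
  proof -
    have "(\<Sum>i<m. 2 * (real i / real n)\<^sup>2) \<le> (\<Sum>i<m. 2 * (real m / real n)\<^sup>2)"
      by (intro sum_mono mult_left_mono power_mono divide_right_mono) auto
    also have "\<dots> = 2 * (real m ^ 3 / (real n)\<^sup>2)"
      by (simp add: power2_eq_square power3_eq_cube)
    also have "\<dots> \<le> 2 * 1"
    proof (intro mult_left_mono)
      have "real (m ^ 3) \<le> real (n\<^sup>2)" using assms(3) by (simp only: of_nat_le_iff)
      then show "real m ^ 3 / (real n)\<^sup>2 \<le> 1"
        using assms(2) by (simp add: divide_le_eq_1)
    qed simp
    finally show ?thesis by simp
  qed
  have "(\<Sum>i<m. real i) \<le> (real m)\<^sup>2 / 2"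
    unfolding sum_lessThan_real by (simp add: power2_eq_square algebra_simps)
  then have "(\<Sum>i<m. real i / real n) \<le> (real m)\<^sup>2 / 2 / real n"
    unfolding sum_divide_distrib[symmetric] by (rule divide_right_mono) simp
  then have "- ((real m)\<^sup>2 / (2 * real n)) - 2 \<le> (\<Sum>i<m. - (real i / real n) - 2 * (real i / real n)\<^sup>2)"
    using sq by (simp add: sum_subtractf sum_negf)
  then have "exp (- ((real m)\<^sup>2 / (2 * real n)) - 2)
      \<le> (\<Prod>i<m. exp (- (real i / real n) - 2 * (real i / real n)\<^sup>2))"
    by (simp add: exp_sum[symmetric])
  also have "\<dots> \<le> (\<Prod>i<m. 1 - real i / real n)"
  proof (intro prod_mono conjI)
    fix i assume "i \<in> {..<m}"
    then have x: "real i / real n \<le> 1 / 2" using i by simp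
    then have "- (real i / real n) - 2 * (real i / real n)\<^sup>2 \<le> ln (1 - real i / real n)"
      by (intro ln_one_minus_pos_lower_bound) auto
    then show "exp (- (real i / real n) - 2 * (real i / real n)\<^sup>2) \<le> 1 - real i / real n"
      using x by (subst (asm) ln_ge_iff) linarith+
  qed auto
  finally show ?thesis .
qed

text \<open>
  One half of Stirling's estimate, with a polynomial loss. The induction step rests on
  \<open>e n ^ (n + 1) \<le> (n + 1) ^ (n + 1)\<close>, which is \<open>1 + x \<le> exp x\<close> at \<open>x = - 1 / (n + 1)\<close>,
  raised to the power \<open>n + 1\<close>.
\<close>

lemma fact_mult_exp_le:
  assumes "n \<ge> 1"
  shows "fact n * exp (real n) \<le> exp 1 * real n ^ Suc n"
  using assms
proof (induction n rule: nat_induct_at_least)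
  case (Suc n)
  have "1 - 1 / real (Suc n) \<le> exp (- (1 / real (Suc n)))"
    using exp_ge_add_one_self[of "- (1 / real (Suc n))"] by simp
  then have "real n / real (Suc n) \<le> exp (- (1 / real (Suc n)))"
    by (simp add: field_simps)
  then have "(real n / real (Suc n)) ^ Suc n \<le> exp (- (1 / real (Suc n))) ^ Suc n"
    by (intro power_mono) auto
  also have "\<dots> = exp (- 1)"
    unfolding exp_of_nat_mult[symmetric] by simp
  finally have *: "exp 1 * real n ^ Suc n \<le> real (Suc n) ^ Suc n"
    by (simp add: power_divide exp_minus field_simps del: power_Suc)
  have "fact (Suc n) * exp (real (Suc n)) = real (Suc n) * exp 1 * (fact n * exp (real n))"
    by (simp add: exp_add algebra_simps)
  also have "\<dots> \<le> real (Suc n) * exp 1 * (exp 1 * real n ^ Suc n)"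
    using Suc by (intro mult_left_mono) auto
  also have "\<dots> \<le> real (Suc n) * exp 1 * real (Suc n) ^ Suc n"
    using * by (intro mult_left_mono) auto
  finally show ?case by (simp add: mult_ac)
qed simp

lemma power_mult_fact_le: "real m ^ k * fact m \<le> fact (m + k)"
proof (induction k)
  case (Suc k)
  have "real m ^ Suc k * fact m \<le> real (m + Suc k) * (real m ^ k * fact m)"
    by (simp add: mult.assoc mult_right_mono)
  also have "\<dots> \<le> real (m + Suc k) * fact (m + k)"
    using Suc by (intro mult_left_mono) auto
  finally show ?case by simp
qed simp

text \<open>
  At \<open>m = j\<^sup>2\<close> the largest summand of the coefficient has about \<open>sqrt m = j\<close> blocks. Taking exactly \<open>j\<close>
  blocks gives \<open>(j\<^sup>2 - 2 choose j - 2) / j!\<close>, roughly \<open>j ^ (2 j) / (j!)\<^sup>2\<close>, which is \<open>exp (2 j)\<close> up to a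
  polynomial factor by Stirling's estimate.
\<close>

lemma perm_gf_square_ge:
  assumes "j \<ge> 2"
  shows "exp (2 * real j - 3) / real j ^ 6 \<le> fps_nth perm_gf (j\<^sup>2)"
proof -
  obtain k where k: "j = k + 2" using assms by (metis le_add_diff_inverse2)
  define c where "c = fps_nth perm_gf (j\<^sup>2)"
  \<comment> \<open>All factors of \<open>(N + k)! / N!\<close> exceed \<open>N\<close>, and \<open>N = j (j - 1)\<close> is a product, so that
     \<open>N ^ k\<close> can be compared with \<open>j ^ (2 k)\<close> at the cost of a factor \<open>e\<close>.\<close>
  define N where "N = j * (j - 1)"
  have j2: "j\<^sup>2 = N + k + 2"
    by (simp add: k N_def power2_eq_square)
  have "real N ^ k * fact N \<le> fact (N + k)" by (rule power_mult_fact_le)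
  also have "\<dots> = fact k * fact N * real (N + k choose k)"
    using binomial_fact_lemma[of k "N + k"] by (metis add_diff_cancel_right' le_add2 of_nat_fact of_nat_mult)
  finally have N: "real N ^ k \<le> fact k * real (N + k choose k)"
    by (simp add: mult_ac)
  have c: "real (N + k choose k) \<le> c * fact j"
    using perm_gf_ge[of k "N + k"] unfolding c_def j2
    by (simp add: k pos_divide_le_eq del: fact_Suc add_2_eq_Suc')
  have "real N ^ k \<le> fact k * (c * fact j)"
    using N c by (meson fact_ge_zero mult_left_mono order_trans)
  also have "\<dots> \<le> fact j * (c * fact j)"
    using fact_mono[of k j, where 'a = real] perm_gf_nonneg by (intro mult_right_mono) (auto simp: c_def k)
  finally have Nc: "real N ^ k \<le> c * (fact j)\<^sup>2"
    by (simp add: power2_eq_square mult_ac)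
  have e: "real j ^ k \<le> exp 1 * real (j - 1) ^ k"
  proof -
    have "real j / real (j - 1) = 1 + 1 / real (j - 1)"
      using k by (simp add: field_simps)
    also have "\<dots> \<le> exp (1 / real (j - 1))" by (rule exp_ge_add_one_self)
    finally have "(real j / real (j - 1)) ^ k \<le> exp (1 / real (j - 1)) ^ k"
      by (intro power_mono) auto
    also have "\<dots> = exp (real k / real (j - 1))"
      unfolding exp_of_nat_mult[symmetric] by simp
    also have "\<dots> \<le> exp 1"
      using k by simp
    finally show ?thesis
      using k by (simp add: power_divide field_simps)
  qed
  have f: "fact j * exp (real j) \<le> exp 1 * real j ^ Suc j"
    using assms by (intro fact_mult_exp_le) simp
  have "(fact j * exp (real j))\<^sup>2 \<le> (exp 1 * real j ^ Suc j)\<^sup>2"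
    using f by (intro power_mono) auto
  also have "\<dots> = (exp 1)\<^sup>2 * real j ^ 6 * (real j ^ k * real j ^ k)"
  proof -
    have "Suc j * 2 = 6 + (k + k)" using k by simp
    then show ?thesis
      by (simp only: power_mult_distrib power_mult[symmetric] power_add[symmetric] mult.assoc)
  qed
  also have "\<dots> \<le> (exp 1)\<^sup>2 * real j ^ 6 * (real j ^ k * (exp 1 * real (j - 1) ^ k))"
    using e by (intro mult_left_mono) auto
  also have "\<dots> = exp 1 ^ 3 * real j ^ 6 * real N ^ k"
    by (simp add: N_def power_mult_distrib power2_eq_square power3_eq_cube mult_ac del: of_nat_diff)
  also have "\<dots> \<le> exp 1 ^ 3 * real j ^ 6 * (c * (fact j)\<^sup>2)"
    using Nc by (intro mult_left_mono) auto
  finally have "(fact j)\<^sup>2 * (exp (real j))\<^sup>2 \<le> (fact j)\<^sup>2 * (exp 1 ^ 3 * real j ^ 6 * c)"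
    by (simp add: power_mult_distrib mult_ac)
  then have "(exp (real j))\<^sup>2 \<le> exp 1 ^ 3 * real j ^ 6 * c"
    by (subst (asm) mult_le_cancel_left_pos) auto
  moreover have "(exp (real j))\<^sup>2 = exp (2 * real j - 3) * exp 1 ^ 3"
    unfolding exp_of_nat_mult[symmetric] exp_add[symmetric] by simp
  ultimately have "exp 1 ^ 3 * exp (2 * real j - 3) \<le> exp 1 ^ 3 * (real j ^ 6 * c)"
    by (simp add: mult_ac)
  then have "exp (2 * real j - 3) \<le> real j ^ 6 * c"
    by (subst (asm) mult_le_cancel_left_pos) auto
  then show ?thesis
    using k by (simp add: c_def field_simps)
qed

text \<open>
  A single summand suffices. The exponent is maximal near \<open>m = n powr (2 / 3)\<close>; the perfect square
  \<open>m = j\<^sup>2\<close> with \<open>j\<close> the integer part of the cube root of \<open>n\<close> is close enough and fits the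
  previous estimate. The condition \<open>n \<ge> 8\<close> guarantees \<open>j \<ge> 2\<close>.
\<close>

lemma expected_B_ge:
  assumes "n \<ge> 8"
  shows "expected_B n \<ge> exp (3 / 2 * root 3 (real n) - 13 / 2) / (real n)\<^sup>2"
proof -
  define a where "a = root 3 (real n)"
  define j where "j = nat \<lfloor>a\<rfloor>"
  have a: "a ^ 3 = real n" "a > 0"
    using assms by (simp_all add: a_def)
  have "root 3 (2 ^ 3) \<le> a"
    unfolding a_def using assms by (subst real_root_le_iff) auto
  then have "2 \<le> a" by (subst (asm) real_root_power_cancel) auto
  then have j: "j \<ge> 2" "real j \<le> a" "a \<le> real j + 1"
    unfolding j_def by linarith+
  have "real j ^ 3 \<le> a ^ 3" using j by (intro power_mono) auto
  then have "real (j ^ 3) \<le> real n" using a by simp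
  then have j3: "j ^ 3 \<le> n" by (simp only: of_nat_le_iff)
  have "2 * j\<^sup>2 \<le> j * j\<^sup>2" using j by (intro mult_right_mono) auto
  also have "\<dots> = j ^ 3" by (simp add: power3_eq_cube power2_eq_square)
  finally have 1: "2 * j\<^sup>2 \<le> n" using j3 by linarith
  have "(j ^ 3)\<^sup>2 \<le> n\<^sup>2" using j3 by (intro power_mono) auto
  then have 2: "(j\<^sup>2) ^ 3 \<le> n\<^sup>2" by (simp add: power_mult[symmetric])
  have 3: "(real (j\<^sup>2))\<^sup>2 / (2 * real n) \<le> real j / 2"
  proof -
    have "(real (j\<^sup>2))\<^sup>2 = real j * real (j ^ 3)"
      by (simp add: power2_eq_square power3_eq_cube)
    also have "\<dots> \<le> real j * real n" using j3 by (intro mult_left_mono) auto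
    finally show ?thesis using assms by (simp add: field_simps)
  qed
  have le: "j\<^sup>2 \<le> n" using 1 by simp
  have P: "exp (- (real j / 2) - 2) \<le> (\<Prod>i<j\<^sup>2. 1 - real i / real n)"
  proof -
    have "exp (- (real j / 2) - 2) \<le> exp (- ((real (j\<^sup>2))\<^sup>2 / (2 * real n)) - 2)"
      using 3 by simp
    also have "\<dots> \<le> (\<Prod>i<j\<^sup>2. 1 - real i / real n)"
      using 1 2 assms by (intro prod_one_minus_ge) auto
    finally show ?thesis .
  qed
  have "exp (3 / 2 * a - 13 / 2) / (real n)\<^sup>2 \<le> exp (3 / 2 * real j - 5) / real j ^ 6"
  proof (intro frac_le)
    have "real ((j\<^sup>2) ^ 3) \<le> real (n\<^sup>2)" using 2 by (simp only: of_nat_le_iff)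
    then show "real j ^ 6 \<le> (real n)\<^sup>2" by (simp add: power_mult[symmetric])
  qed (use j in auto)
  also have "\<dots> = exp (2 * real j - 3) / real j ^ 6 * exp (- (real j / 2) - 2)"
    by (simp add: exp_add[symmetric])
  also have "\<dots> \<le> fps_nth perm_gf (j\<^sup>2) * (\<Prod>i<j\<^sup>2. 1 - real i / real n)"
    using P perm_gf_square_ge[OF j(1)] perm_gf_nonneg by (intro mult_mono) auto
  also have "\<dots> \<le> (\<Sum>m=0..n. fps_nth perm_gf m * (\<Prod>i<m. 1 - real i / real n))"
    using le
    by (intro member_le_sum[of "j\<^sup>2" "{0..n}" "\<lambda>m. fps_nth perm_gf m * (\<Prod>i<m. 1 - real i / real n)"]
        mult_nonneg_nonneg perm_gf_nonneg prod_nonneg) (auto simp: divide_le_eq_1)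
  also have "\<dots> = expected_B n"
    using assms by (intro expected_B_eq_sum[symmetric]) simp
  finally show ?thesis by (simp add: a_def)
qed

section \<open>The asymptotic formula\<close>

lemma expected_B_pos:
  assumes "n \<ge> 1"
  shows "expected_B n > 0"
proof -
  have "0 < fps_nth perm_gf 0 * (\<Prod>i<0. 1 - real i / real n)"
    by (simp add: perm_gf_0)
  also have "\<dots> \<le> expected_B n"
    unfolding expected_B_eq_sum[OF assms]
    by (intro member_le_sum[of 0 "{0..n}" "\<lambda>m. fps_nth perm_gf m * (\<Prod>i<m. 1 - real i / real n)"]
        mult_nonneg_nonneg perm_gf_nonneg prod_nonneg) (auto simp: divide_le_eq_1)
  finally show ?thesis .
qed

theorem theorem2:
  "\<exists>g :: nat \<Rightarrow> real. g \<in> O(\<lambda>n. real n powr (1 / 6)) \<and>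
     (\<forall>n\<ge>1. expected_B n = exp (3 / 2 * root 3 (real n) + g n))"
proof (intro exI conjI allI impI)
  let ?g = "\<lambda>n. ln (expected_B n) - 3 / 2 * root 3 (real n)"
  show "expected_B n = exp (3 / 2 * root 3 (real n) + ?g n)" if "n \<ge> 1" for n
    using expected_B_pos[OF that] by simp
  have bound: "\<bar>?g n\<bar> \<le> 7 + 2 * ln (real n + 1)" if n: "n \<ge> 8" for n
  proof -
    have pos: "expected_B n > 0" using n by (intro expected_B_pos) simp
    have "ln (expected_B n) \<le> ln ((real n + 1) * exp (3 / 2 * root 3 (real n) + 1 / 2))"
      using pos n expected_B_le[of n] by (subst ln_le_cancel_iff) auto
    then have up: "?g n \<le> ln (real n + 1) + 1 / 2"
      by (simp add: ln_mult)
    have "ln (exp (3 / 2 * root 3 (real n) - 13 / 2) / (real n)\<^sup>2) \<le> ln (expected_B n)"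
      using pos n expected_B_ge[OF n] by (subst ln_le_cancel_iff) auto
    then have "?g n \<ge> - 13 / 2 - 2 * ln (real n)"
      using n by (simp add: ln_div ln_realpow)
    moreover have "ln (real n) \<le> ln (real n + 1)" "ln (real n + 1) \<ge> 0"
      using n by simp_all
    ultimately show ?thesis using up by linarith
  qed
  have "?g \<in> O(\<lambda>n. 7 + 2 * ln (real n + 1))"
  proof (rule bigoI[where c = 1])
    show "\<forall>\<^sub>F n in sequentially. norm (?g n) \<le> 1 * norm (7 + 2 * ln (real n + 1))"
      using eventually_ge_at_top[of 8] by eventually_elim (use bound in \<open>force intro: order_trans\<close>)
  qed
  also have "(\<lambda>n. 7 + 2 * ln (real n + 1)) \<in> O(\<lambda>n. real n powr (1 / 6))"
    by real_asymp
  finally show "?g \<in> O(\<lambda>n. real n powr (1 / 6))" .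
qed

end
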